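(* Let $A$ and $B$ partition the vertex set of a graph $G$. Suppose $\mathring{s}(G[A])\le c_A|A|$ and $\mathring{s}(G[B])\le c_B|B|$, and let $\gamma$ be a constant satisfying $\frac{c_A}{c_A+c_B}\le\gamma\le\frac{|A|}{|A|+|B|}$. Then $$\mathring{s}(G)\le\Bigl(\sqrt{c_A\gamma}+\sqrt{c_B(1-\gamma)}\Bigr)^2|V(G)|.$$
   Context: The slow-coloring game on a graph $G$: initially all vertices are uncolored. In each round, Lister marks a nonempty set $M$ of uncolored vertices and scores $|M|$; Painter then colors (with a new color) a subset $X\subseteq M$ that is independent in $G$. The game ends when all vertices are colored; the score is the sum of the sizes of all marked sets. Painter minimizes, Lister maximizes. The sum-color cost $\mathring{s}(G)$ is the score under optimal play by both players. $G[A]$ denotes the subgraph induced by $A$. *)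

theory Defs
  imports Complex_Main "Graph_Theory.Digraph_Component"
begin

text \<open>A finite simple graph is a \<^term>\<open>graph\<close> of the Graph-Theory library: every
  edge is represented by a pair of opposite arcs.\<close>

definition independent_set :: "('a, 'b) pre_digraph \<Rightarrow> 'a set \<Rightarrow> bool" where
  "independent_set G X \<longleftrightarrow> (\<forall>u\<in>X. \<forall>v\<in>X. \<not> u \<rightarrow>\<^bsub>G\<^esub> v)"

text \<open>\<open>painter_limits G U k\<close>: in the slow-coloring game on \<open>G\<close> with set \<open>U\<close> of uncolored
  vertices, Painter has a strategy under which the game ends with total further score at most
  \<open>k\<close>. Painter may answer with \<open>X = {}\<close>; the definition is nevertheless well-founded since
  \<open>M\<close> is nonempty. When \<open>U = {}\<close> the game is over and the premise is vacuous.\<close>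

inductive painter_limits :: "('a, 'b) pre_digraph \<Rightarrow> 'a set \<Rightarrow> nat \<Rightarrow> bool" for G where
  "(\<And>M. M \<subseteq> U \<Longrightarrow> M \<noteq> {} \<Longrightarrow> card M \<le> k \<and>
      (\<exists>X\<subseteq>M. independent_set G X \<and> painter_limits G (U - X) (k - card M)))
    \<Longrightarrow> painter_limits G U k"

text \<open>\<open>lister_forces G U k\<close>: Lister has a strategy under which the total further score
  reaches at least \<open>k\<close>. (Truncated subtraction: once \<open>card M \<ge> k\<close> the target is met.)\<close>

inductive lister_forces :: "('a, 'b) pre_digraph \<Rightarrow> 'a set \<Rightarrow> nat \<Rightarrow> bool" for G where
  "lister_forces G U 0"
| "M \<subseteq> U \<Longrightarrow> M \<noteq> {} \<Longrightarrow>
    (\<And>X. X \<subseteq> M \<Longrightarrow> independent_set G X \<Longrightarrow> lister_forces G (U - X) (k - card M))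
    \<Longrightarrow> lister_forces G U k"

text \<open>The value of the game from its initial position. By the lemmas below it is also the
  largest score that Lister can force, so it is the score under optimal play by both players.\<close>

definition sum_color_cost :: "('a, 'b) pre_digraph \<Rightarrow> nat" where
  "sum_color_cost G = (LEAST k. painter_limits G (verts G) k)"

lemma painter_limits_iff:
  "painter_limits G U k \<longleftrightarrow> (\<forall>M. M \<subseteq> U \<longrightarrow> M \<noteq> {} \<longrightarrow> card M \<le> k \<and>
      (\<exists>X\<subseteq>M. independent_set G X \<and> painter_limits G (U - X) (k - card M)))"
  by (subst painter_limits.simps) blast

lemma lister_forces_iff:
  "lister_forces G U k \<longleftrightarrow> k = 0 \<or> (\<exists>M. M \<subseteq> U \<and> M \<noteq> {} \<and>
      (\<forall>X. X \<subseteq> M \<longrightarrow> independent_set G X \<longrightarrow> lister_forces G (U - X) (k - card M)))"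
  by (subst lister_forces.simps) blast

lemma not_painter_limits_iff:
  assumes "finite U"
  shows "\<not> painter_limits G U k \<longleftrightarrow> lister_forces G U (Suc k)"
  using assms
proof (induction k arbitrary: U rule: less_induct)
  case (less k)
  have *: "\<not> (card M \<le> k \<and>
            (\<exists>X\<subseteq>M. independent_set G X \<and> painter_limits G (U - X) (k - card M)))
      \<longleftrightarrow> (\<forall>X. X \<subseteq> M \<longrightarrow> independent_set G X \<longrightarrow> lister_forces G (U - X) (Suc k - card M))"
    if M: "M \<subseteq> U" "M \<noteq> {}" for M
  proof (cases "card M \<le> k")
    case True
    have "card M > 0"
      using M less.prems by (meson card_gt_0_iff finite_subset)
    hence "\<not> painter_limits G (U - X) (k - card M)
        \<longleftrightarrow> lister_forces G (U - X) (Suc k - card M)" for X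
      using less.IH[of "k - card M" "U - X"] less.prems True by (simp add: Suc_diff_le)
    with True show ?thesis by blast
  next
    case False
    thus ?thesis by (auto simp: not_le Suc_le_eq intro: lister_forces.intros(1))
  qed
  have "\<not> painter_limits G U k \<longleftrightarrow> (\<exists>M. M \<subseteq> U \<and> M \<noteq> {} \<and> \<not> (card M \<le> k \<and>
            (\<exists>X\<subseteq>M. independent_set G X \<and> painter_limits G (U - X) (k - card M))))"
    by (subst painter_limits_iff) simp
  also have "\<dots> \<longleftrightarrow> (\<exists>M. M \<subseteq> U \<and> M \<noteq> {} \<and>
      (\<forall>X. X \<subseteq> M \<longrightarrow> independent_set G X \<longrightarrow> lister_forces G (U - X) (Suc k - card M)))"
    using * by (intro ex_cong1) (metis (no_types, lifting))
  also have "\<dots> \<longleftrightarrow> lister_forces G U (Suc k)"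
    by (subst (2) lister_forces_iff) simp
  finally show ?case .
qed

lemma painter_limits_square:
  assumes "loopfree_digraph G" "finite U"
  shows "painter_limits G U (card U * card U)"
  using assms(2)
proof (induction "card U" arbitrary: U rule: less_induct)
  case less
  have "card M \<le> card U * card U \<and> (\<exists>X\<subseteq>M. independent_set G X \<and>
      painter_limits G (U - X) (card U * card U - card M))" if M: "M \<subseteq> U" "M \<noteq> {}" for M
  proof -
    obtain v where v: "v \<in> M" using M by blast
    have le: "card M \<le> card U" using M less.prems by (simp add: card_mono)
    obtain n where n: "card U = Suc n"
      using v M less.prems by (metis card_eq_0_iff empty_iff not0_implies_Suc subsetD)
    have cn: "card (U - {v}) = n" using n v M less.prems by auto
    have mono: "painter_limits G W k \<Longrightarrow> k \<le> k' \<Longrightarrow> painter_limits G W k'" for W k k'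
    proof (induction arbitrary: k' rule: painter_limits.induct)
      case (1 W k)
      show ?case
      proof (rule painter_limits.intros)
        fix N assume N: "N \<subseteq> W" "N \<noteq> {}"
        show "card N \<le> k' \<and>
            (\<exists>X\<subseteq>N. independent_set G X \<and> painter_limits G (W - X) (k' - card N))"
          using 1(1)[OF N] 1(2) by (meson diff_le_mono le_trans)
      qed
    qed
    have "painter_limits G (U - {v}) (n * n)"
      using less.hyps[of "U - {v}"] less.prems n cn by simp
    moreover have "n * n \<le> card U * card U - card M" using le n by simp
    ultimately have "painter_limits G (U - {v}) (card U * card U - card M)"
      by (rule mono)
    moreover have "independent_set G {v}"
      using loopfree_digraph.adj_not_same[OF assms(1)] by (auto simp: independent_set_def)
    moreover have "card M \<le> card U * card U" using le n by simp
    ultimately show ?thesis using v by blast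
  qed
  thus ?case by (rule painter_limits.intros)
qed

lemma painter_limits_sum_color_cost:
  assumes "graph G"
  shows "painter_limits G (verts G) (sum_color_cost G)"
proof -
  interpret graph G by fact
  show ?thesis unfolding sum_color_cost_def
    by (rule LeastI, rule painter_limits_square) (auto intro: loopfree_digraph_axioms)
qed

lemma lister_forces_sum_color_cost:
  assumes "graph G"
  shows "lister_forces G (verts G) (sum_color_cost G)"
proof (cases "sum_color_cost G")
  case 0
  thus ?thesis by (simp add: lister_forces.intros(1))
next
  case (Suc k)
  interpret graph G by fact
  have "\<not> painter_limits G (verts G) k"
    using Suc not_less_Least[of k "painter_limits G (verts G)"] unfolding sum_color_cost_def by simp
  thus ?thesis using Suc by (simp add: not_painter_limits_iff)
qed

lemma card_le_sum_color_cost: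
  assumes "graph G"
  shows "card (verts G) \<le> sum_color_cost G"
proof (cases "verts G = {}")
  case False
  thus ?thesis
    using painter_limits_sum_color_cost[OF assms]
    by (subst (asm) painter_limits_iff) blast
qed simp

end

theory Submission
  imports Defs
begin

text \<open>If Painter can keep the remaining scores on the two parts below \<open>p\<close> and \<open>q\<close>, he can keep
  the total below \<open>(\<surd>p + \<surd>q)\<^sup>2\<close>. Suppose Lister marks \<open>a\<close> vertices of the first part and \<open>b\<close> of
  the second. Painter answers in one part only: in the first if \<open>a \<surd>q \<ge> b \<surd>p\<close>, otherwise in the
  second. Answering in the first part lowers the term \<open>2\<surd>(pq)\<close> of the potential by at least
  \<open>a \<surd>(q/p) \<ge> b\<close>, which pays for the vertices marked in vain in the second part. The theorem
  follows because \<open>x \<mapsto> \<surd>(c\<^sub>A x) + \<surd>(c\<^sub>B (1 - x))\<close> decreases to the right of its maximum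
  \<open>c\<^sub>A / (c\<^sub>A + c\<^sub>B)\<close>.\<close>

text \<open>With \<open>r\<close>, \<open>s\<close>, \<open>t\<close> the square roots of
  \<open>p\<close>, \<open>p - a\<close>, \<open>q\<close>, the potential drops by exactly
  \<open>a + 2 * t * (r - s)\<close>. Since \<open>r - s = a / (r + s) \<ge> a / (2 * r)\<close>,
  the part beyond \<open>a\<close> is at least \<open>a * t / r\<close>, hence at least
  \<open>b\<close>.\<close>

lemma sqrt_potential_decrease:
  fixes a b p q :: real
  assumes "0 < a" "a \<le> p" "0 \<le> q" "b * sqrt p \<le> a * sqrt q"
  shows "(sqrt (p - a) + sqrt q)\<^sup>2 + a + b \<le> (sqrt p + sqrt q)\<^sup>2"
proof -
  define r s t where "r = sqrt p" and "s = sqrt (p - a)" and "t = sqrt q"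
  have r: "r > 0" and s: "s \<ge> 0" "s \<le> r" and t: "t \<ge> 0"
    using assms by (auto simp: r_def s_def t_def)
  have sq: "r\<^sup>2 = p" "s\<^sup>2 = p - a" "t\<^sup>2 = q"
    using assms by (auto simp: r_def s_def t_def)
  have "b * r \<le> a * t"
    using assms(4) by (simp add: r_def t_def)
  also have "a = (r - s) * (r + s)"
    using sq by (simp add: algebra_simps power2_eq_square)
  also have "(r - s) * (r + s) * t = t * (r - s) * (r + s)"
    by (simp add: mult_ac)
  also have "\<dots> \<le> t * (r - s) * (2 * r)"
    using s t by (intro mult_left_mono) auto
  finally have "b * r \<le> (2 * t * (r - s)) * r"
    by (simp add: mult_ac)
  hence "b \<le> 2 * t * (r - s)"
    using r by (simp only: mult_le_cancel_right_pos)
  moreover have "(r + t)\<^sup>2 - (s + t)\<^sup>2 = a + 2 * t * (r - s)"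
    using sq by (simp add: power2_sum algebra_simps)
  ultimately show ?thesis
    by (simp add: r_def s_def t_def)
qed

lemma painter_limitsE:
  assumes "painter_limits G U k" "M \<subseteq> U" "M \<noteq> {}"
  obtains X where "card M \<le> k" "X \<subseteq> M" "independent_set G X"
    "painter_limits G (U - X) (k - card M)"
  using assms by (subst (asm) painter_limits_iff) blast

text \<open>The strict bound by \<open>k + 1\<close> makes the least admissible \<open>k\<close> the floor, not the ceiling, of the
  potential.\<close>

lemma painter_limits_Un:
  assumes "finite U" "finite V" "U \<inter> V = {}"
    and "painter_limits G U p" "painter_limits G V q"
    and "(sqrt (real p) + sqrt (real q))\<^sup>2 < real k + 1"
  shows "painter_limits G (U \<union> V) k"
  using assms
proof (induction "p + q" arbitrary: U V p q k rule: less_induct)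
  case less
  \<comment> \<open>The primed data stand for \<open>U, V, p, q\<close> or for the swapped
    \<open>V, U, q, p\<close>. Induction runs on the scores because \<open>X\<close> may be empty
    and leave the uncolored set unchanged, whereas \<open>p'\<close> always drops by
    \<open>?a > 0\<close>.\<close>
  have answer: "card M \<le> k \<and> (\<exists>X\<subseteq>M. independent_set G X \<and>
      painter_limits G (U' \<union> V' - X) (k - card M))"
    if M: "M \<subseteq> U' \<union> V'" "M \<inter> U' \<noteq> {}"
      and UV: "finite U'" "finite V'" "U' \<inter> V' = {}" "p' + q' = p + q"
      and lim: "painter_limits G U' p'" "painter_limits G V' q'"
      and pot: "(sqrt (real p') + sqrt (real q'))\<^sup>2 < real k + 1"
      and le: "real (card (M \<inter> V')) * sqrt (real p') \<le> real (card (M \<inter> U')) * sqrt (real q')"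
    for M U' V' p' q'
  proof -
    let ?a = "card (M \<inter> U')" and ?b = "card (M \<inter> V')"
    obtain X where X: "?a \<le> p'" "X \<subseteq> M \<inter> U'" "independent_set G X"
      "painter_limits G (U' - X) (p' - ?a)"
      using painter_limitsE[OF lim(1) _ M(2)] by blast
    have a: "0 < ?a"
      using M(2) UV(1) by (simp add: card_gt_0_iff)
    have "M = (M \<inter> U') \<union> (M \<inter> V')"
      using M(1) by blast
    moreover have "card \<dots> = ?a + ?b"
      using UV by (intro card_Un_disjoint) auto
    ultimately have cM: "card M = ?a + ?b"
      by simp
    have "(sqrt (real (p' - ?a)) + sqrt (real q'))\<^sup>2 + real ?a + real ?b < real k + 1"
      using sqrt_potential_decrease[of "real ?a" "real p'" "real q'" "real ?b"] a X(1) le pot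
      by (simp add: of_nat_diff)
    hence bound: "(sqrt (real (p' - ?a)) + sqrt (real q'))\<^sup>2 + real (card M) < real k + 1"
      by (simp add: cM)
    have "real (card M) < real k + 1"
      by (rule le_less_trans[OF _ bound]) simp
    hence k: "card M \<le> k"
      by simp
    have "painter_limits G ((U' - X) \<union> V') (k - card M)"
    proof (rule less.hyps)
      show "p' - ?a + q' < p + q"
        using a X(1) UV(4) by linarith
      show "(sqrt (real (p' - ?a)) + sqrt (real q'))\<^sup>2 < real (k - card M) + 1"
        using bound k by (simp add: of_nat_diff)
    qed (use UV X lim in auto)
    moreover have "(U' - X) \<union> V' = U' \<union> V' - X"
      using X(2) UV(3) by blast
    ultimately show ?thesis
      using k X(2,3) by auto
  qed
  show ?case
  proof (rule painter_limits.intros)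
    fix M assume M: "M \<subseteq> U \<union> V" "M \<noteq> {}"
    let ?a = "card (M \<inter> U)" and ?b = "card (M \<inter> V)"
    show "card M \<le> k \<and> (\<exists>X\<subseteq>M. independent_set G X \<and>
        painter_limits G (U \<union> V - X) (k - card M))"
    proof (cases "M \<inter> U \<noteq> {} \<and> real ?b * sqrt (real p) \<le> real ?a * sqrt (real q)")
      case True
      thus ?thesis
        using answer[of M U V p q] M less.prems by blast
    next
      case False
      \<comment> \<open>If \<open>M \<inter> V\<close> were empty, then \<open>?b = 0\<close> and
        \<open>M\<close> would meet \<open>U\<close>, which is the previous case. If
        \<open>M \<inter> U\<close> is empty, then \<open>?a = 0\<close> and the inequality is
        trivial.\<close>
      have "M \<inter> V \<noteq> {}" "real ?a * sqrt (real q) \<le> real ?b * sqrt (real p)"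
        using False M by auto
      thus ?thesis
        using answer[of M V U q p] M less.prems by (simp add: Un_commute Int_commute add.commute)
    qed
  qed
qed

lemma independent_set_induce_subgraph:
  "X \<subseteq> S \<Longrightarrow> independent_set (G \<restriction> S) X \<longleftrightarrow> independent_set G X"
  unfolding independent_set_def arcs_ends_def arc_to_ends_def by fastforce

text \<open>Lets both parts be played inside the single graph \<open>G\<close>: Painter's answers
  carry over because \<open>G\<close> and \<open>G \<restriction> S\<close> have the same
  adjacencies within \<open>S\<close>.\<close>

lemma painter_limits_of_induce_subgraph:
  assumes "painter_limits (G \<restriction> S) U k" "U \<subseteq> S"
  shows "painter_limits G U k"
  using assms
proof (induction rule: painter_limits.induct)
  case (1 U k)
  show ?case
  proof (rule painter_limits.intros)
    fix M assume M: "M \<subseteq> U" "M \<noteq> {}"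
    obtain X where X: "X \<subseteq> M" "independent_set (G \<restriction> S) X"
        "U - X \<subseteq> S \<Longrightarrow> painter_limits G (U - X) (k - card M)" "card M \<le> k"
      using 1(1)[OF M] by blast
    have "independent_set G X"
      using X(1,2) M(1) 1(2) independent_set_induce_subgraph[of X S G] by blast
    moreover have "painter_limits G (U - X) (k - card M)"
      using X(3) 1(2) by blast
    ultimately show "card M \<le> k \<and> (\<exists>X\<subseteq>M. independent_set G X \<and>
        painter_limits G (U - X) (k - card M))"
      using X(1,4) by blast
  qed
qed

lemma painter_limits_sum_color_cost_induce_subgraph:
  assumes "graph G" "S \<subseteq> verts G"
  shows "painter_limits G S (sum_color_cost (G \<restriction> S))"
proof -
  interpret graph G by fact
  have ind: "induced_subgraph (G \<restriction> S) G"
    using assms(2) by (rule induced_induce)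
  have "graph (G \<restriction> S)"
    using digraphI_induced[OF ind] induced_graph_imp_graph[OF ind]
    by (simp add: graph_def pseudo_graph_def digraph_def)
  from painter_limits_sum_color_cost[OF this] show ?thesis
    by (auto intro: painter_limits_of_induce_subgraph)
qed

lemma sum_color_cost_partition:
  assumes "graph G" "A \<union> B = verts G" "A \<inter> B = {}"
  shows "real (sum_color_cost G)
    \<le> (sqrt (real (sum_color_cost (G \<restriction> A))) + sqrt (real (sum_color_cost (G \<restriction> B))))\<^sup>2"
    (is "_ \<le> ?f")
proof -
  interpret graph G by fact
  have fin: "finite A" "finite B"
    using finite_verts unfolding assms(2)[symmetric] by auto
  have "painter_limits G (A \<union> B) (nat \<lfloor>?f\<rfloor>)"
  proof (rule painter_limits_Un[OF fin assms(3)])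
    show "painter_limits G A (sum_color_cost (G \<restriction> A))" "painter_limits G B (sum_color_cost (G \<restriction> B))"
      using assms(2) by (auto intro!: painter_limits_sum_color_cost_induce_subgraph[OF assms(1)])
    show "?f < real (nat \<lfloor>?f\<rfloor>) + 1"
      by linarith
  qed
  hence "sum_color_cost G \<le> nat \<lfloor>?f\<rfloor>"
    unfolding sum_color_cost_def assms(2) by (rule Least_le)
  thus ?thesis
    by (simp add: le_nat_floor le_nat_iff le_floor_iff)
qed

text \<open>The proof avoids derivatives: the gain of the first term is compared with the loss of
  the second by factoring \<open>y - x = (1 - x) - (1 - y)\<close> as a difference of squares in two
  ways.\<close>

lemma weighted_sqrt_sum_antimono:
  fixes c d x y :: real
  assumes "0 \<le> c" "0 \<le> d" "0 < c + d" "c / (c + d) \<le> x" "x \<le> y" "y \<le> 1"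
  shows "sqrt (c * y) + sqrt (d * (1 - y)) \<le> sqrt (c * x) + sqrt (d * (1 - x))"
proof -
  have x0: "0 \<le> x"
    using assms(1-4) by (smt (verit) divide_nonneg_pos)
  \<comment> \<open>After taking roots, this says that the derivative at \<open>z\<close> is not
    positive.\<close>
  have slope: "c * (1 - z) \<le> d * z" if "c / (c + d) \<le> z" for z
    using that assms(3) by (simp add: field_simps)
  define P Q where "P = sqrt c" and "Q = sqrt d"
  let ?r = "sqrt y" and ?s = "sqrt x" and ?t = "sqrt (1 - x)" and ?u = "sqrt (1 - y)"
  have "P * ?t \<le> Q * ?s" "P * ?u \<le> Q * ?r"
    using slope[of x] slope[of y] assms(4,5) by (auto simp: P_def Q_def simp flip: real_sqrt_mult)
  hence ratio: "P * (?t + ?u) \<le> Q * (?r + ?s)"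
    by (simp add: algebra_simps)
  have "P * (?r - ?s) \<le> Q * (?t - ?u)"
  proof (cases "?t + ?u = 0")
    case True
    hence "x = 1" "y = 1"
      using assms(5,6) by (auto simp: add_nonneg_eq_0_iff)
    thus ?thesis by simp
  next
    case False
    hence pos: "?t + ?u > 0"
      using assms(5,6) by (smt (verit) real_sqrt_ge_zero)
    have "P * (?r - ?s) * (?t + ?u) = (?r - ?s) * (P * (?t + ?u))"
      by (simp add: mult_ac)
    also have "\<dots> \<le> (?r - ?s) * (Q * (?r + ?s))"
      using ratio assms(5) by (intro mult_left_mono) auto
    also have "\<dots> = Q * (?r\<^sup>2 - ?s\<^sup>2)"
      by (simp add: algebra_simps power2_eq_square)
    also have "\<dots> = Q * (?t\<^sup>2 - ?u\<^sup>2)"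
      using x0 assms(5,6) by simp
    also have "\<dots> = Q * (?t - ?u) * (?t + ?u)"
      by (simp add: algebra_simps power2_eq_square)
    finally show ?thesis
      using pos by (simp only: mult_le_cancel_right_pos)
  qed
  thus ?thesis
    unfolding real_sqrt_mult P_def Q_def by (simp add: right_diff_distrib)
qed

theorem theorem11:
  fixes G :: "('a, 'b) pre_digraph" and A B :: "'a set" and c\<^sub>A c\<^sub>B \<gamma> :: real
  assumes "graph G"
    and "A \<union> B = verts G" and "A \<inter> B = {}"
    and "0 \<le> c\<^sub>A" and "0 \<le> c\<^sub>B"
    and "real (sum_color_cost (G \<restriction> A)) \<le> c\<^sub>A * real (card A)"
    and "real (sum_color_cost (G \<restriction> B)) \<le> c\<^sub>B * real (card B)"
    and "c\<^sub>A / (c\<^sub>A + c\<^sub>B) \<le> \<gamma>"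
    and "\<gamma> \<le> real (card A) / (real (card A) + real (card B))"
  shows "real (sum_color_cost G)
    \<le> (sqrt (c\<^sub>A * \<gamma>) + sqrt (c\<^sub>B * (1 - \<gamma>)))\<^sup>2 * real (card (verts G))"
proof -
  interpret graph G by fact
  define n where "n = real (card (verts G))"
  \<comment> \<open>The largest value allowed for \<open>\<gamma>\<close>. There the claimed bound
    equals the one in \<open>cost\<close>, and moving left to \<open>\<gamma>\<close> can only
    increase it.\<close>
  define \<alpha> where "\<alpha> = real (card A) / n"
  have "finite A" "finite B"
    using finite_verts unfolding assms(2)[symmetric] by auto
  hence n: "n = real (card A) + real (card B)"
    using assms(3) by (simp add: n_def card_Un_disjoint flip: assms(2))
  have cost: "real (sum_color_cost G) \<le> (sqrt (c\<^sub>A * real (card A)) + sqrt (c\<^sub>B * real (card B)))\<^sup>2"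
    by (rule order_trans[OF sum_color_cost_partition[OF assms(1-3)]])
      (use assms(6,7) in \<open>intro power_mono add_mono real_sqrt_le_mono; simp\<close>)
  show ?thesis
  \<comment> \<open>Sets apart the zero denominators, where division yields 0. Both products in
    \<open>cost\<close> then vanish, and the claimed bound is nonnegative as a square times a
    cardinality.\<close>
  proof (cases "n = 0 \<or> c\<^sub>A + c\<^sub>B = 0")
    case True
    hence "c\<^sub>A * real (card A) = 0" "c\<^sub>B * real (card B) = 0"
      using n assms(4,5) by auto
    hence "real (sum_color_cost G) \<le> 0"
      using cost by (simp only: real_sqrt_zero) simp
    also have "0 \<le> (sqrt (c\<^sub>A * \<gamma>) + sqrt (c\<^sub>B * (1 - \<gamma>)))\<^sup>2 * real (card (verts G))"
      by simp
    finally show ?thesis .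
  next
    case False
    hence pos: "0 < n" "0 < c\<^sub>A + c\<^sub>B"
      using n assms(4,5) by auto
    have \<alpha>: "\<gamma> \<le> \<alpha>" "0 \<le> \<alpha>" "\<alpha> \<le> 1"
      using assms(9) pos n by (auto simp: \<alpha>_def)
    have "real (card A) = \<alpha> * n" "real (card B) = (1 - \<alpha>) * n"
      using pos(1) n by (auto simp: \<alpha>_def field_simps)
    hence "sqrt (c\<^sub>A * real (card A)) + sqrt (c\<^sub>B * real (card B))
        = (sqrt (c\<^sub>A * \<alpha>) + sqrt (c\<^sub>B * (1 - \<alpha>))) * sqrt n"
      by (simp add: real_sqrt_mult distrib_right)
    hence "real (sum_color_cost G) \<le> (sqrt (c\<^sub>A * \<alpha>) + sqrt (c\<^sub>B * (1 - \<alpha>)))\<^sup>2 * n"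
      using cost pos(1) by (simp add: power_mult_distrib)
    also have "\<dots> \<le> (sqrt (c\<^sub>A * \<gamma>) + sqrt (c\<^sub>B * (1 - \<gamma>)))\<^sup>2 * n"
      using weighted_sqrt_sum_antimono[OF assms(4,5) pos(2) assms(8) \<alpha>(1,3)] \<alpha> assms(4,5) pos
      by (intro mult_right_mono power_mono) auto
    finally show ?thesis
      by (simp add: n_def)
  qed
qed

end
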